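(* (i) Let $k,s,f_0,f_1\in\mathbb Z$ and let $(f_n)_{n\in\mathbb Z}$ be the bilateral sequence determined by $f_0,f_1$ and $$f_n=\begin{cases} k f_{n-1}-f_{n-2} & n \text{ even},\\ s f_{n-1}-f_{n-2} & n\text{ odd},\end{cases}$$ (applied forwards and backwards). Put $b_n=f_{n-1}f_n$. Then for all $n$, $b_n=\alpha b_{n-1}-b_{n-2}+\beta$ with $$\alpha=ks-2,\qquad \beta=kf_1^2+sf_0^2-ks\,f_0f_1,$$ and (provided not all $b_n$ vanish) $(b_n)$ is a lens sequence with constants $\alpha,\beta$. (ii) Every integer lens sequence arises as in (i) for suitable integers $k,s,f_0,f_1$. In particular, if $(b_n)$ is a primitive integer lens sequence and $(b_0,b_1,b_2)=(a,b,c)$ with $b\neq 0$, one may take $f_0=\pm\gcd(a,b)$, $f_1=\pm\gcd(b,c)$ with signs chosen so that $f_0f_1=b$, and $s=\frac{a+b}{f_0^2}$, $k=\frac{b+c}{f_1^2}$.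
   Context: A lens sequence is a bilateral real sequence $(b_n)_{n\in\mathbb Z}$ satisfying $b_n=\alpha b_{n-1}-b_{n-2}+\beta$ for all $n$, where for some (equivalently every) index $m$ with $b_m\neq0$ the constants satisfy $\alpha=\frac{b_{m-1}b_m+b_mb_{m+1}+b_{m+1}b_{m-1}}{b_m^2}-1$ and $\beta=\frac{b_m^2-b_{m-1}b_{m+1}}{b_m}$. An integer lens sequence has all terms in $\mathbb Z$; it is primitive if the gcd of three consecutive terms is $1$.
   Formalization: The claim that every integer lens sequence arises as in (i) is false (constant sequence 3); what is proved is that every primitive one arises as in (i), and every integer lens sequence is gcd(b_0,b_1,b_2) times a sequence arising as in (i). *)

theory Defs
  imports Complex_Main
begin

definition lens_sequence_with :: "real \<Rightarrow> real \<Rightarrow> (int \<Rightarrow> real) \<Rightarrow> bool" where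
  "lens_sequence_with \<alpha> \<beta> b \<longleftrightarrow>
     (\<forall>n. b n = \<alpha> * b (n - 1) - b (n - 2) + \<beta>) \<and>
     (\<exists>m. b m \<noteq> 0 \<and>
        \<alpha> = (b (m - 1) * b m + b m * b (m + 1) + b (m + 1) * b (m - 1)) / (b m)\<^sup>2 - 1 \<and>
        \<beta> = ((b m)\<^sup>2 - b (m - 1) * b (m + 1)) / b m)"

text \<open>The choice of \<open>m\<close> above is immaterial: both equations for the constants hold at \<open>m\<close>
  iff \<open>x\<^sup>2 + y\<^sup>2 - \<alpha> x y - \<beta> (x + y)\<close>, which takes the same value at all pairs
  \<open>x = b (n - 1)\<close>, \<open>y = b n\<close>, vanishes.\<close>

lemma lens_sequence_with_every:
  assumes "lens_sequence_with \<alpha> \<beta> b" "b j \<noteq> 0"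
  shows "\<alpha> = (b (j - 1) * b j + b j * b (j + 1) + b (j + 1) * b (j - 1)) / (b j)\<^sup>2 - 1"
    and "\<beta> = ((b j)\<^sup>2 - b (j - 1) * b (j + 1)) / b j"
proof -
  from assms(1) obtain m where rec: "\<And>n. b n = \<alpha> * b (n - 1) - b (n - 2) + \<beta>" and m: "b m \<noteq> 0"
    and bm: "\<beta> = ((b m)\<^sup>2 - b (m - 1) * b (m + 1)) / b m"
    unfolding lens_sequence_with_def by blast
  have rec': "b (n + 1) = \<alpha> * b n - b (n - 1) + \<beta>" for n
    using rec[of "n + 1"] by simp
  define Q where "Q n = (b (n - 1))\<^sup>2 + (b n)\<^sup>2 - \<alpha> * b (n - 1) * b n - \<beta> * (b (n - 1) + b n)" for n
  have step: "Q (n + 1) = Q n" for n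
    unfolding Q_def by (simp add: rec'[of n]) algebra
  have "Q (m + int i) = Q m" for i
  proof (induction i)
    case (Suc i)
    then show ?case using step[of "m + int i"] by (simp add: ac_simps)
  qed simp
  moreover have "Q (m - int i) = Q m" for i
  proof (induction i)
    case (Suc i)
    then show ?case using step[of "m - int i - 1"] by (simp add: algebra_simps)
  qed simp
  ultimately have Qc: "Q n = Q m" for n
    by (cases "n - m" rule: int_cases2) (metis add_diff_cancel_left' diff_add_cancel add.commute,
      metis diff_add_cancel uminus_add_conv_diff)
  have "\<beta> * b m = (b m)\<^sup>2 - b (m - 1) * b (m + 1)" using bm m by simp
  then have "Q m = 0" unfolding Q_def rec'[of m] by algebra
  then have Q0: "Q j = 0" using Qc by simp
  then have B: "\<beta> * b j = (b j)\<^sup>2 - b (j - 1) * b (j + 1)" unfolding Q_def rec'[of j] by algebra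
  then show "\<beta> = ((b j)\<^sup>2 - b (j - 1) * b (j + 1)) / b j" using assms(2) by (simp add: field_simps)
  have "(\<alpha> + 1) * (b j)\<^sup>2 = b (j - 1) * b j + b j * b (j + 1) + b (j + 1) * b (j - 1)"
    using B unfolding rec'[of j] by algebra
  then show "\<alpha> = (b (j - 1) * b j + b j * b (j + 1) + b (j + 1) * b (j - 1)) / (b j)\<^sup>2 - 1"
    using assms(2) by (simp add: field_simps)
qed

definition lens_sequence :: "(int \<Rightarrow> real) \<Rightarrow> bool" where
  "lens_sequence b \<longleftrightarrow> (\<exists>\<alpha> \<beta>. lens_sequence_with \<alpha> \<beta> b)"

definition integer_lens_sequence :: "(int \<Rightarrow> int) \<Rightarrow> bool" where
  "integer_lens_sequence b \<longleftrightarrow> lens_sequence (\<lambda>n. real_of_int (b n))"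

text \<open>For an integer lens sequence the gcd of three consecutive terms does not depend on their
  position; as a hypothesis, the existential form below is the weakest reading.\<close>

definition primitive_lens_sequence :: "(int \<Rightarrow> int) \<Rightarrow> bool" where
  "primitive_lens_sequence b \<longleftrightarrow>
     integer_lens_sequence b \<and> (\<exists>n. gcd (b (n - 1)) (gcd (b n) (b (n + 1))) = 1)"

definition is_f_seq :: "int \<Rightarrow> int \<Rightarrow> int \<Rightarrow> int \<Rightarrow> (int \<Rightarrow> int) \<Rightarrow> bool" where
  "is_f_seq k s f0 f1 f \<longleftrightarrow> f 0 = f0 \<and> f 1 = f1 \<and>
     (\<forall>n. f n = (if even n then k * f (n - 1) - f (n - 2) else s * f (n - 1) - f (n - 2)))"

definition f_seq :: "int \<Rightarrow> int \<Rightarrow> int \<Rightarrow> int \<Rightarrow> int \<Rightarrow> int" where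
  "f_seq k s f0 f1 = (THE f. is_f_seq k s f0 f1 f)"

definition f_prod :: "int \<Rightarrow> int \<Rightarrow> int \<Rightarrow> int \<Rightarrow> int \<Rightarrow> int" where
  "f_prod k s f0 f1 n = f_seq k s f0 f1 (n - 1) * f_seq k s f0 f1 n"

fun f_fwd :: "int \<Rightarrow> int \<Rightarrow> int \<Rightarrow> int \<Rightarrow> nat \<Rightarrow> int" where
  "f_fwd k s x y 0 = x"
| "f_fwd k s x y (Suc 0) = y"
| "f_fwd k s x y (Suc (Suc n)) =
     (if even n then k else s) * f_fwd k s x y (Suc n) - f_fwd k s x y n"

lemma is_f_seq_exists: "\<exists>f. is_f_seq k s f0 f1 f"
proof -
  define f where "f n = (if n \<ge> 0 then f_fwd k s f0 f1 (nat n) else f_fwd s k f1 f0 (nat (1 - n)))"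
    for n :: int
  have neg: "f n = f_fwd s k f1 f0 (nat (1 - n))" if "n \<le> 1" for n
  proof -
    have "n < 0 \<or> n = 0 \<or> n = 1" using that by linarith
    then show ?thesis by (auto simp: f_def)
  qed
  have rec: "f n = (if even n then k else s) * f (n - 1) - f (n - 2)" for n
  proof (cases "n \<ge> 2")
    case True
    then have m: "n = int (nat (n - 2)) + 2" by simp
    define m where "m = nat (n - 2)"
    note m = m[folded m_def]
    have "nat n = Suc (Suc m)" "nat (n - 1) = Suc m" "nat (n - 2) = m" using m by auto
    moreover have "even n \<longleftrightarrow> even m" using m by simp
    ultimately show ?thesis using True by (simp add: f_def)
  next
    case False
    then have m: "n = 1 - int (nat (1 - n))" by simp
    define m where "m = nat (1 - n)"
    note m = m[folded m_def]
    have "nat (1 - n) = m" "nat (1 - (n - 1)) = Suc m" "nat (1 - (n - 2)) = Suc (Suc m)"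
      using m by auto
    moreover have "even n \<longleftrightarrow> odd m" using m by simp
    ultimately show ?thesis using False neg[of n] neg[of "n - 1"] neg[of "n - 2"] by simp
  qed
  have "f n = (if even n then k * f (n - 1) - f (n - 2) else s * f (n - 1) - f (n - 2))" for n
    by (subst rec) simp
  moreover have "f 0 = f0" "f 1 = f1" by (simp_all add: f_def)
  ultimately have "is_f_seq k s f0 f1 f"
    unfolding is_f_seq_def by blast
  then show ?thesis by blast
qed

lemma is_f_seq_unique:
  assumes "is_f_seq k s f0 f1 f" "is_f_seq k s f0 f1 g"
  shows "f = g"
proof -
  have init: "f 0 = g 0" "f 1 = g 1" using assms unfolding is_f_seq_def by metis+
  have up: "f (int n) = g (int n) \<and> f (int n + 1) = g (int n + 1)" for n
  proof (induction n)
    case 0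
    then show ?case using init by simp
  next
    case (Suc n)
    have "h (int n + 2) =
        (if even (int n) then k else s) * h (int n + 1) - h (int n)"
      if "is_f_seq k s f0 f1 h" for h
    proof -
      have "h (int n + 2) = (if even (int n + 2) then k * h (int n + 2 - 1) - h (int n + 2 - 2)
          else s * h (int n + 2 - 1) - h (int n + 2 - 2))"
        using that unfolding is_f_seq_def by blast
      then show ?thesis by (auto simp: add.commute)
    qed
    from this[OF assms(1)] this[OF assms(2)] Suc show ?case
      by (simp add: add.commute)
  qed
  have down: "f (- int n) = g (- int n) \<and> f (1 - int n) = g (1 - int n)" for n
  proof (induction n)
    case 0
    then show ?case using init by simp
  next
    case (Suc n)
    have "h (- 1 - int n) =
        (if even (1 - int n) then k else s) * h (- int n) - h (1 - int n)"
      if "is_f_seq k s f0 f1 h" for h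
    proof -
      have "h (1 - int n) = (if even (1 - int n) then k * h (1 - int n - 1) - h (1 - int n - 2)
          else s * h (1 - int n - 1) - h (1 - int n - 2))"
        using that unfolding is_f_seq_def by blast
      then show ?thesis by auto
    qed
    from this[OF assms(1)] this[OF assms(2)] Suc show ?case
      by simp
  qed
  show ?thesis
  proof
    fix n :: int
    show "f n = g n"
      by (cases n rule: int_cases2) (use up down in auto)
  qed
qed

lemma is_f_seq_f_seq: "is_f_seq k s f0 f1 (f_seq k s f0 f1)"
  unfolding f_seq_def
  by (rule theI'[where P = "is_f_seq k s f0 f1"]) (use is_f_seq_exists is_f_seq_unique in blast)

text \<open>The literal claim that every integer lens sequence is of the form \<^term>\<open>f_prod k s f0 f1\<close>
  fails without primitivity: the constant sequence 3 would need integers with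
  \<open>f0 * f1 = 3\<close>, \<open>s * f0\<^sup>2 = 6\<close> and \<open>k * f1\<^sup>2 = 6\<close>.\<close>

lemma integer_lens_sequence_const_3: "integer_lens_sequence (\<lambda>_. 3)"
  unfolding integer_lens_sequence_def lens_sequence_def lens_sequence_with_def
  by (rule exI[of _ 2], rule exI[of _ 0]) simp

lemma const_3_not_f_prod: "f_prod k s f0 f1 \<noteq> (\<lambda>_. 3)"
proof
  assume eq: "f_prod k s f0 f1 = (\<lambda>_. 3)"
  define f where "f = f_seq k s f0 f1"
  have F: "is_f_seq k s f0 f1 f" by (simp add: f_def is_f_seq_f_seq)
  have P: "f (n - 1) * f n = 3" for n
    using fun_cong[OF eq, of n] by (simp add: f_prod_def f_def)
  have r: "f n = (if even n then k * f (n - 1) - f (n - 2) else s * f (n - 1) - f (n - 2))" for n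
    using F unfolding is_f_seq_def by blast
  have f01: "f 0 * f 1 = 3" "f (-1) * f 0 = 3" "f 1 * f 2 = 3"
    using P[of 1] P[of 0] P[of 2] by simp_all
  have rr: "f 1 = s * f 0 - f (-1)" "f 2 = k * f 1 - f 0" using r[of 1] r[of 2] by simp_all
  have a: "s * f 0 = f 1 + f (-1)" and b: "k * f 1 = f 2 + f 0" using rr by simp_all
  have "f 0 * (s * f 0) = 6" "f 1 * (k * f 1) = 6"
    unfolding a b using f01 by (simp_all add: algebra_simps)
  then have s: "(f 0)\<^sup>2 * s = 6" "(f 1)\<^sup>2 * k = 6" by (simp_all add: power2_eq_square algebra_simps)
  have "f 0 dvd 3" using f01(1) by (metis dvd_triv_left)
  then have "\<bar>f 0\<bar> \<le> 3" using dvd_imp_le_int[of 3 "f 0"] by simp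
  then have "f 0 = -3 \<or> f 0 = -2 \<or> f 0 = -1 \<or> f 0 = 0 \<or> f 0 = 1 \<or> f 0 = 2 \<or> f 0 = 3"
    by linarith
  then have "(f 0 = 3 \<or> f 0 = -3) \<or> (f 1 = 3 \<or> f 1 = -3)"
    using f01(1) by (elim disjE) (simp_all, presburger+)
  then have "9 * s = 6 \<or> 9 * k = 6" using s by (elim disjE) simp_all
  then show False by presburger
qed

end

theory Submission
  imports Defs
begin

text \<open>
  For three consecutive terms \<open>a, b, c\<close> of an integer lens sequence with \<open>b \<noteq> 0\<close>, the two constants
  satisfy \<open>b (b - \<beta>) = a c\<close> and \<open>(\<alpha> + 1) b\<^sup>2 = a b + b c + c a\<close>. If \<open>gcd(a, b, c) = 1\<close>, the first
  relation forces \<open>b = u v\<close> with \<open>u = \<plusminus>gcd(a, b)\<close>, \<open>v = \<plusminus>gcd(b, c)\<close>. Writing \<open>a = u a'\<close>, \<open>c = v c'\<close>,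
  the second becomes \<open>(\<alpha> + 2) u v = (a' + v) (u + c')\<close>, and coprimality of \<open>u, c'\<close> and of \<open>v, a'\<close>
  gives integers \<open>s = (a' + v) / u\<close> and \<open>k = (u + c') / v\<close>. The sequence and the product sequence
  then obey the same recurrence and agree at 0 and 1. That \<open>\<alpha>\<close> is an integer follows by descent:
  a denominator of \<open>\<alpha>\<close> divides all differences \<open>b n - b (n - 1)\<close> arbitrarily often, so these vanish
  or the denominator is 1.
\<close>

section \<open>Induction along the integers and uniqueness for recurrences\<close>

lemma int_shift_invariant:
  fixes P :: "int \<Rightarrow> bool"
  assumes "P m" "\<And>n. P n \<longleftrightarrow> P (n + 1)"
  shows "P n"
proof (induction n rule: int_induct[of _ m])
  case (step2 i)
  then show ?case using assms(2)[of "i - 1"] by simp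
qed (use assms in auto)

text \<open>The coefficient -1 of \<open>b (n - 2)\<close> makes the recurrence reversible, so
  agreement of one adjacent pair spreads in both directions.\<close>

lemma affine_recurrence_unique:
  fixes b c :: "int \<Rightarrow> 'a :: comm_ring_1"
  assumes b: "\<And>n. b n = \<alpha> * b (n - 1) - b (n - 2) + \<beta>"
    and c: "\<And>n. c n = \<alpha> * c (n - 1) - c (n - 2) + \<beta>"
    and init: "b 0 = c 0" "b 1 = c 1"
  shows "b n = c n"
proof -
  have "b n = c n \<and> b (n + 1) = c (n + 1)"
  proof (induct n rule: int_shift_invariant[where m = 0])
    show "b 0 = c 0 \<and> b (0 + 1) = c (0 + 1)" using init by simp
    fix n
    have step: "b (n + 1 + 1) = \<alpha> * b (n + 1) - b n + \<beta>" "c (n + 1 + 1) = \<alpha> * c (n + 1) - c n + \<beta>"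
      using b[of "n + 1 + 1"] c[of "n + 1 + 1"] by (simp_all add: algebra_simps)
    show "(b n = c n \<and> b (n + 1) = c (n + 1)) =
        (b (n + 1) = c (n + 1) \<and> b (n + 1 + 1) = c (n + 1 + 1))"
      unfolding step by auto
  qed
  then show ?thesis by simp
qed

section \<open>The alternating sequence and its products\<close>

lemma f_seq_0 [simp]: "f_seq k s f0 f1 0 = f0"
  and f_seq_1 [simp]: "f_seq k s f0 f1 1 = f1"
  using is_f_seq_f_seq[of k s f0 f1] unfolding is_f_seq_def by blast+

lemma f_seq_rec:
  "f_seq k s f0 f1 n = (if even n then k else s) * f_seq k s f0 f1 (n - 1) - f_seq k s f0 f1 (n - 2)"
proof -
  have "f_seq k s f0 f1 n = (if even n then k * f_seq k s f0 f1 (n - 1) - f_seq k s f0 f1 (n - 2)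
      else s * f_seq k s f0 f1 (n - 1) - f_seq k s f0 f1 (n - 2))"
    using is_f_seq_f_seq[of k s f0 f1] unfolding is_f_seq_def by blast
  then show ?thesis by simp
qed

text \<open>Vieta jumping: the neighbours \<open>x\<close> and \<open>z\<close> of \<open>y\<close>
  have sum \<open>c k s (n + 1) * y\<close>, so \<open>t * (t - c k s (n + 1) * y)\<close> takes the
  same value \<open>- x * z\<close> at \<open>t = x\<close> and \<open>t = z\<close>. This expresses
  \<beta> at every position.\<close>

lemma f_seq_quadratic_invariant:
  defines "c \<equiv> \<lambda>k s n. if even n then k else s :: int"
  shows "c k s n * (f_seq k s f0 f1 (n - 1))\<^sup>2 + c k s (n + 1) * (f_seq k s f0 f1 n)\<^sup>2
      - k * s * f_seq k s f0 f1 (n - 1) * f_seq k s f0 f1 n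
    = k * f1\<^sup>2 + s * f0\<^sup>2 - k * s * f0 * f1"
proof (induct n rule: int_shift_invariant[where m = 1])
  show "c k s 1 * (f_seq k s f0 f1 (1 - 1))\<^sup>2 + c k s (1 + 1) * (f_seq k s f0 f1 1)\<^sup>2
      - k * s * f_seq k s f0 f1 (1 - 1) * f_seq k s f0 f1 1
    = k * f1\<^sup>2 + s * f0\<^sup>2 - k * s * f0 * f1"
    by (simp add: c_def)
  fix n
  define x y z where "x = f_seq k s f0 f1 (n - 1)" "y = f_seq k s f0 f1 n" "z = f_seq k s f0 f1 (n + 1)"
  have z: "z = c k s (n + 1) * y - x"
    using f_seq_rec[of k s f0 f1 "n + 1"] by (simp add: c_def x_y_z_def)
  \<comment> \<open>\<open>n\<close> and \<open>n + 1\<close> have opposite parity, so each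
    multiplier occurs once; \<open>c\<close> has period 2.\<close>
  have "k * s = c k s n * c k s (n + 1)" "c k s (n + 1 + 1) = c k s n" by (simp_all add: c_def)
  then have "c k s n * x\<^sup>2 + c k s (n + 1) * y\<^sup>2 - k * s * x * y
      = c k s (n + 1) * y\<^sup>2 + c k s (n + 1 + 1) * z\<^sup>2 - k * s * y * z"
    unfolding z by algebra
  then show "(c k s n * (f_seq k s f0 f1 (n - 1))\<^sup>2 + c k s (n + 1) * (f_seq k s f0 f1 n)\<^sup>2
      - k * s * f_seq k s f0 f1 (n - 1) * f_seq k s f0 f1 n
      = k * f1\<^sup>2 + s * f0\<^sup>2 - k * s * f0 * f1) =
    (c k s (n + 1) * (f_seq k s f0 f1 (n + 1 - 1))\<^sup>2 + c k s (n + 1 + 1) * (f_seq k s f0 f1 (n + 1))\<^sup>2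
      - k * s * f_seq k s f0 f1 (n + 1 - 1) * f_seq k s f0 f1 (n + 1)
      = k * f1\<^sup>2 + s * f0\<^sup>2 - k * s * f0 * f1)"
    unfolding x_y_z_def by (simp only: add_diff_cancel_right')
qed

text \<open>Three consecutive products are polynomials in two terms \<open>x\<close>,
  \<open>y\<close> and the multipliers \<open>p\<close>, \<open>q\<close>; once the invariant
  rewrites \<beta> in these variables, both relations are polynomial identities. The second is the
  lens formula for \<beta> without division.\<close>

lemma f_prod_relations:
  fixes k s f0 f1 :: int
  defines "b \<equiv> f_prod k s f0 f1" and "\<beta> \<equiv> k * f1\<^sup>2 + s * f0\<^sup>2 - k * s * f0 * f1"
  shows "b (n + 1) = (k * s - 2) * b n - b (n - 1) + \<beta>"
    and "\<beta> * b n = (b n)\<^sup>2 - b (n - 1) * b (n + 1)"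
proof -
  define p q where "p = (if even n then k else s)" "q = (if even (n + 1) then k else s)"
  define x y where "x = f_seq k s f0 f1 (n - 1)" "y = f_seq k s f0 f1 n"
  have ks: "k * s = p * q" by (simp add: p_q_def)
  have f: "f_seq k s f0 f1 (n + 1) = q * y - x" "f_seq k s f0 f1 (n - 2) = p * x - y"
    using f_seq_rec[of k s f0 f1 "n + 1"] f_seq_rec[of k s f0 f1 n] by (simp_all add: p_q_def x_y_def)
  have b: "b n = x * y" "b (n + 1) = y * (q * y - x)" "b (n - 1) = (p * x - y) * x"
    using f by (simp_all add: b_def f_prod_def x_y_def)
  have \<beta>: "\<beta> = p * x\<^sup>2 + q * y\<^sup>2 - p * q * x * y"
    using f_seq_quadratic_invariant[of n k s f0 f1] ks
    unfolding \<beta>_def p_q_def x_y_def by simp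
  show "b (n + 1) = (k * s - 2) * b n - b (n - 1) + \<beta>"
    unfolding ks b \<beta> by algebra
  show "\<beta> * b n = (b n)\<^sup>2 - b (n - 1) * b (n + 1)"
    unfolding b \<beta> by algebra
qed

lemma f_prod_rec:
  "f_prod k s f0 f1 n = (k * s - 2) * f_prod k s f0 f1 (n - 1) - f_prod k s f0 f1 (n - 2)
    + (k * f1\<^sup>2 + s * f0\<^sup>2 - k * s * f0 * f1)"
  using f_prod_relations(1)[of k s f0 f1 "n - 1"] by simp

text \<open>Multiplying the recurrence at \<open>m + 1\<close> by \<open>b m\<close> and inserting
  the relation for \<beta> yields the formula for \<alpha>.\<close>

lemma lens_sequence_withI:
  assumes rec: "\<And>n. b n = \<alpha> * b (n - 1) - b (n - 2) + \<beta>"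
    and m: "b m \<noteq> 0" and \<beta>: "\<beta> * b m = (b m)\<^sup>2 - b (m - 1) * b (m + 1)"
  shows "lens_sequence_with \<alpha> \<beta> b"
proof -
  have "b (m + 1) = \<alpha> * b m - b (m - 1) + \<beta>" using rec[of "m + 1"] by simp
  then have "(\<alpha> + 1) * (b m)\<^sup>2 = b (m - 1) * b m + b m * b (m + 1) + b (m + 1) * b (m - 1)"
    using \<beta> by algebra
  then have "\<alpha> = (b (m - 1) * b m + b m * b (m + 1) + b (m + 1) * b (m - 1)) / (b m)\<^sup>2 - 1"
    using m by (simp add: field_simps)
  moreover have "\<beta> = ((b m)\<^sup>2 - b (m - 1) * b (m + 1)) / b m"
    using m \<beta> by (simp add: field_simps)
  ultimately show ?thesis unfolding lens_sequence_with_def using rec m by blast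
qed

lemma f_prod_lens_sequence_with:
  assumes "f_prod k s f0 f1 m \<noteq> 0"
  shows "lens_sequence_with (real_of_int (k * s - 2))
    (real_of_int (k * f1\<^sup>2 + s * f0\<^sup>2 - k * s * f0 * f1)) (\<lambda>n. real_of_int (f_prod k s f0 f1 n))"
proof (rule lens_sequence_withI[where m = m])
  fix n
  show "real_of_int (f_prod k s f0 f1 n) = real_of_int (k * s - 2) * real_of_int (f_prod k s f0 f1 (n - 1))
      - real_of_int (f_prod k s f0 f1 (n - 2)) + real_of_int (k * f1\<^sup>2 + s * f0\<^sup>2 - k * s * f0 * f1)"
    using arg_cong[OF f_prod_rec[of k s f0 f1 n], of real_of_int] by simp
  show "real_of_int (k * f1\<^sup>2 + s * f0\<^sup>2 - k * s * f0 * f1) * real_of_int (f_prod k s f0 f1 m)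
      = (real_of_int (f_prod k s f0 f1 m))\<^sup>2
        - real_of_int (f_prod k s f0 f1 (m - 1)) * real_of_int (f_prod k s f0 f1 (m + 1))"
    using arg_cong[OF f_prod_relations(2)[of k f1 s f0 m], of real_of_int] by simp
qed (use assms in simp)

section \<open>Integrality of the constants\<close>

text \<open>Being coprime to \<open>p\<close>, \<open>q\<close> divides every term, and dividing it
  out leaves the same recurrence; hence every power of \<open>q\<close> divides the nonzero
  \<open>d n\<close>.\<close>

lemma homogeneous_recurrence_denominator:
  fixes d :: "int \<Rightarrow> int"
  assumes rec: "\<And>n. q * (d (n + 1) + d (n - 1)) = p * d n"
    and cop: "coprime p q" and nz: "d n \<noteq> 0"
  shows "\<bar>q\<bar> \<le> 1"
proof (rule ccontr)
  assume "\<not> \<bar>q\<bar> \<le> 1"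
  then have q2: "2 \<le> \<bar>q\<bar>" by simp
  have pow: "\<forall>n. q ^ i dvd d n" for i
  proof (induction i)
    case (Suc i)
    then obtain e where e: "\<And>n. d n = q ^ i * e n" unfolding dvd_def by metis
    have "q \<noteq> 0" using q2 by auto
    have "q dvd e n" for n
    proof -
      have "q ^ i * (q * (e (n + 1) + e (n - 1))) = q ^ i * (p * e n)"
        using rec[of n] by (simp add: e algebra_simps)
      then have "q * (e (n + 1) + e (n - 1)) = p * e n" using \<open>q \<noteq> 0\<close> by simp
      then have "q dvd p * e n" by (metis dvd_triv_left)
      then show ?thesis using cop by (simp add: coprime_commute coprime_dvd_mult_right_iff)
    qed
    then show ?case using e by (simp add: mult.commute mult_dvd_mono)
  qed simp
  \<comment> \<open>With this exponent \<open>q ^ i\<close> exceeds \<open>d n\<close> in absolute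
    value, because \<open>i < 2 ^ i\<close>.\<close>
  define i where "i = nat \<bar>d n\<bar>"
  have "\<bar>q ^ i\<bar> \<le> \<bar>d n\<bar>" using pow[of i] nz dvd_imp_le_int by auto
  moreover have "(2::int) ^ i \<le> \<bar>q ^ i\<bar>" using q2 by (simp add: power_abs power_mono)
  moreover have "int i < 2 ^ i" by (rule of_nat_less_two_power)
  ultimately show False by (simp add: i_def)
qed

lemma integer_lens_sequence_constants:
  assumes "integer_lens_sequence b"
  obtains \<alpha> \<beta> :: int where
    "lens_sequence_with (real_of_int \<alpha>) (real_of_int \<beta>) (\<lambda>n. real_of_int (b n))"
proof -
  define r where "r = (\<lambda>n. real_of_int (b n))"
  from assms obtain x y where L: "lens_sequence_with x y r"
    unfolding integer_lens_sequence_def lens_sequence_def r_def by blast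
  then obtain m where rec: "\<And>n. r n = x * r (n - 1) - r (n - 2) + y" and m: "r m \<noteq> 0"
    and x: "x = (r (m - 1) * r m + r m * r (m + 1) + r (m + 1) * r (m - 1)) / (r m)\<^sup>2 - 1"
    unfolding lens_sequence_with_def by blast
  have "x \<in> \<int>"
  proof (cases "\<forall>n. b n = b (n + 1)")
    \<comment> \<open>All differences vanish, so descent says nothing; the lens formula at
      \<open>m\<close> gives the value 3 - 1.\<close>
    case True
    have const: "b n = b m" for n
      by (induct n rule: int_shift_invariant[where m = m]) (use True in auto)
    have "x = (3 * (r m)\<^sup>2) / (r m)\<^sup>2 - 1"
      using const[of "m - 1"] const[of "m + 1"] unfolding x by (simp add: r_def power2_eq_square)
    then have "x = 2" using m by simp
    then show ?thesis by simp
  next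
    case False
    then obtain n0 where n0: "b n0 \<noteq> b (n0 + 1)" by blast
    have "x \<in> \<rat>" unfolding x by (auto simp: r_def intro!: Rats_diff Rats_divide Rats_add Rats_mult Rats_power)
    then obtain p q :: int where q: "q > 0" "coprime p q" and xpq: "x = real_of_int p / real_of_int q"
      by (metis Rats_cases')
    \<comment> \<open>Subtracting consecutive instances of the recurrence removes \<open>y\<close>,
      so the differences \<open>b (n + 1) - b n\<close> satisfy a homogeneous one with coefficient
      \<open>p / q\<close>.\<close>
    have "q * ((b (n + 1 + 1) - b (n + 1)) + (b (n - 1 + 1) - b (n - 1))) = p * (b (n + 1) - b n)" for n
    proof -
      have "r (n + 1 + 1) - r (n + 1) + (r (n - 1 + 1) - r (n - 1)) = x * (r (n + 1) - r n)"
        using rec[of "n + 1 + 1"] rec[of "n + 1"] by (simp add: algebra_simps)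
      then have "real_of_int q * (r (n + 1 + 1) - r (n + 1) + (r (n - 1 + 1) - r (n - 1)))
          = real_of_int p * (r (n + 1) - r n)"
        using q by (simp add: xpq)
      then have "real_of_int (q * ((b (n + 1 + 1) - b (n + 1)) + (b (n - 1 + 1) - b (n - 1))))
          = real_of_int (p * (b (n + 1) - b n))"
        by (simp add: r_def)
      then show ?thesis by (simp only: of_int_eq_iff)
    qed
    then have "\<bar>q\<bar> \<le> 1"
      using homogeneous_recurrence_denominator[where d = "\<lambda>n. b (n + 1) - b n" and n = n0] q n0 by force
    then have "q = 1" using q by simp
    then show ?thesis by (simp add: xpq)
  qed
  moreover have "y = r 2 - x * r 1 + r 0" using rec[of 2] by simp
  ultimately have "y \<in> \<int>" by (simp add: r_def)
  show ?thesis using L \<open>x \<in> \<int>\<close> \<open>y \<in> \<int>\<close> that unfolding r_def by (metis Ints_cases)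
qed

section \<open>Division-free form over the integers\<close>

text \<open>The product relation is imposed at zeros of \<open>b\<close> too, so that it applies at
  index 1 whether or not \<open>b 1\<close> vanishes.\<close>

definition integer_lens_with :: "int \<Rightarrow> int \<Rightarrow> (int \<Rightarrow> int) \<Rightarrow> bool" where
  "integer_lens_with \<alpha> \<beta> b \<longleftrightarrow>
     (\<forall>n. b n = \<alpha> * b (n - 1) - b (n - 2) + \<beta>) \<and>
     (\<forall>n. \<beta> * b n = (b n)\<^sup>2 - b (n - 1) * b (n + 1)) \<and> (\<exists>m. b m \<noteq> 0)"

lemma integer_lens_withD:
  assumes "integer_lens_with \<alpha> \<beta> b"
  shows "b n = \<alpha> * b (n - 1) - b (n - 2) + \<beta>"
    and "\<beta> * b n = (b n)\<^sup>2 - b (n - 1) * b (n + 1)"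
    and "\<exists>m. b m \<noteq> 0"
  using assms unfolding integer_lens_with_def by blast+

lemma integer_lens_sequence_obtains_integer_lens_with:
  assumes "integer_lens_sequence b"
  obtains \<alpha> \<beta> where "integer_lens_with \<alpha> \<beta> b"
proof -
  obtain \<alpha> \<beta> :: int where L: "lens_sequence_with (real_of_int \<alpha>) (real_of_int \<beta>) (\<lambda>n. real_of_int (b n))"
    using integer_lens_sequence_constants[OF assms] by blast
  have rec: "b n = \<alpha> * b (n - 1) - b (n - 2) + \<beta>" for n
  proof -
    have "real_of_int (b n) = real_of_int \<alpha> * real_of_int (b (n - 1)) - real_of_int (b (n - 2))
        + real_of_int \<beta>"
      using L unfolding lens_sequence_with_def by blast
    also have "\<dots> = real_of_int (\<alpha> * b (n - 1) - b (n - 2) + \<beta>)" by simp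
    finally show ?thesis by (simp only: of_int_eq_iff)
  qed
  have nz: "\<beta> * b n = (b n)\<^sup>2 - b (n - 1) * b (n + 1)" if "b n \<noteq> 0" for n
  proof -
    have "real_of_int (\<beta> * b n) = real_of_int ((b n)\<^sup>2 - b (n - 1) * b (n + 1))"
      using lens_sequence_with_every(2)[OF L, of n] that by simp
    then show ?thesis by (simp only: of_int_eq_iff)
  qed
  have "\<beta> * b n = (b n)\<^sup>2 - b (n - 1) * b (n + 1)" for n
  proof (cases "b n = 0 \<and> b (n - 1) \<noteq> 0")
    case False
    then show ?thesis using nz[of n] by (cases "b n = 0") simp_all
  next
    \<comment> \<open>The relation at \<open>n - 1\<close> gives \<beta> = \<open>b (n - 1)\<close>;
      the recurrence then gives \<open>b (n + 1) = 0\<close>.\<close>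
    case True
    then have "\<beta> = b (n - 1)" using nz[of "n - 1"] by (simp add: power2_eq_square)
    then show ?thesis using True rec[of "n + 1"] by simp
  qed
  moreover have "\<exists>m. b m \<noteq> 0"
    using L unfolding lens_sequence_with_def of_int_eq_0_iff by blast
  ultimately have "integer_lens_with \<alpha> \<beta> b" unfolding integer_lens_with_def using rec by blast
  then show ?thesis by (rule that)
qed

section \<open>Common divisors and primitivity\<close>

text \<open>A common divisor of three consecutive terms divides \<beta>; modulo it the recurrence is
  homogeneous and carries divisibility of an adjacent pair both ways. As the right-hand side is free
  of \<open>n\<close>, the gcd of a triple does not depend on its position.\<close>

lemma affine_recurrence_dvd_iff:
  fixes b :: "int \<Rightarrow> int"
  assumes rec: "\<And>n. b n = \<alpha> * b (n - 1) - b (n - 2) + \<beta>"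
  shows "g dvd gcd (b (n - 1)) (gcd (b n) (b (n + 1))) \<longleftrightarrow> g dvd \<beta> \<and> (\<forall>m. g dvd b m)"
proof
  assume g: "g dvd gcd (b (n - 1)) (gcd (b n) (b (n + 1)))"
  have rec': "b (m + 1) = \<alpha> * b m - b (m - 1) + \<beta>" for m using rec[of "m + 1"] by simp
  have "\<beta> = b (n + 1) - \<alpha> * b n + b (n - 1)" using rec'[of n] by simp
  then have \<beta>: "g dvd \<beta>" using g by simp
  have "g dvd b (m - 1) \<and> g dvd b m" for m
  proof (induct m rule: int_shift_invariant[where m = n])
    fix m
    have "b (m - 1) = \<alpha> * b m - b (m + 1) + \<beta>" using rec'[of m] by simp
    then have "g dvd b (m + 1) \<longleftrightarrow> g dvd b (m - 1)" if "g dvd b m"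
      using that \<beta> rec'[of m] by (metis dvd_add dvd_diff dvd_mult)
    then show "(g dvd b (m - 1) \<and> g dvd b m) = (g dvd b (m + 1 - 1) \<and> g dvd b (m + 1))" by auto
  qed (use g in auto)
  then show "g dvd \<beta> \<and> (\<forall>m. g dvd b m)" using \<beta> by blast
qed auto

lemma primitive_lens_sequence_gcd:
  assumes "primitive_lens_sequence b"
  shows "gcd (b 0) (gcd (b 1) (b 2)) = 1"
proof -
  have I: "integer_lens_sequence b" using assms by (simp add: primitive_lens_sequence_def)
  from assms obtain n where n: "gcd (b (n - 1)) (gcd (b n) (b (n + 1))) = 1"
    unfolding primitive_lens_sequence_def by metis
  obtain \<alpha> \<beta> where L: "integer_lens_with \<alpha> \<beta> b"
    using integer_lens_sequence_obtains_integer_lens_with[OF I] by blast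
  note rec = integer_lens_withD(1)[OF L] and prd = integer_lens_withD(2)[OF L]
  define g where "g = gcd (b 0) (gcd (b 1) (b 2))"
  have "g dvd gcd (b (1 - 1)) (gcd (b 1) (b (1 + 1)))" by (simp add: g_def)
  then have "g dvd gcd (b (n - 1)) (gcd (b n) (b (n + 1)))"
    using affine_recurrence_dvd_iff[of b, OF rec] by blast
  then have "g dvd 1" using n by simp
  then show ?thesis using zdvd1_eq[of g] by (simp add: g_def)
qed

section \<open>Primitive sequences as product sequences\<close>

text \<open>Dividing \<open>a\<close> and \<open>b\<close> by \<open>gcd a b\<close> leaves a
  cofactor of \<open>b\<close> that must divide \<open>c\<close>, hence \<open>gcd b c\<close>.
  Conversely, the two gcds are coprime divisors of \<open>b\<close>.\<close>

lemma abs_gcd_mult_gcd: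
  fixes a b c :: int
  assumes "b dvd a * c" "gcd a (gcd b c) = 1" "b \<noteq> 0"
  shows "\<bar>b\<bar> = gcd a b * gcd b c"
proof (rule zdvd_antisym_abs[of b "gcd a b * gcd b c", simplified abs_mult abs_gcd_int])
  obtain a' b' where ab: "a = gcd a b * a'" "b = gcd a b * b'" "coprime a' b'"
    using assms(3) by (metis gcd_coprime_exists gcd_eq_0_iff mult.commute)
  have "gcd a b * b' dvd gcd a b * (a' * c)" using assms(1) ab by (metis mult.assoc)
  then have "b' dvd a' * c" using assms(3) by simp
  then have "b' dvd c" using ab(3) by (simp add: coprime_commute coprime_dvd_mult_right_iff)
  moreover have "b' dvd b" using ab(2) by (metis dvd_triv_right)
  ultimately have "b' dvd gcd b c" by simp
  then show "b dvd gcd a b * gcd b c" using ab(2) by (metis dvd_refl mult_dvd_mono)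
  have "coprime (gcd a b) (gcd b c)"
    using assms(2) by (simp add: coprime_iff_gcd_eq_1 gcd.assoc gcd.left_commute)
  then show "gcd a b * gcd b c dvd b" by (simp add: divides_mult)
qed

text \<open>\<open>u\<close> and \<open>v\<close> are fixed only by absolute values and product, so
  every admissible choice of signs is covered.\<close>

lemma primitive_lens_sequence_eq_f_prod:
  assumes prim: "primitive_lens_sequence b" and nz: "b 1 \<noteq> 0"
    and u: "\<bar>u\<bar> = gcd (b 0) (b 1)" and v: "\<bar>v\<bar> = gcd (b 1) (b 2)" and uv: "u * v = b 1"
  obtains k s where "b 0 + b 1 = s * u\<^sup>2" "b 1 + b 2 = k * v\<^sup>2" "\<And>n. b n = f_prod k s u v n"
proof -
  have I: "integer_lens_sequence b" using prim by (simp add: primitive_lens_sequence_def)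
  obtain \<alpha> \<beta> where L: "integer_lens_with \<alpha> \<beta> b"
    using integer_lens_sequence_obtains_integer_lens_with[OF I] by blast
  note rec = integer_lens_withD(1)[OF L] and prd = integer_lens_withD(2)[OF L]
  have g: "gcd (b 0) (gcd (b 1) (b 2)) = 1" by (rule primitive_lens_sequence_gcd[OF prim])
  have nz': "u \<noteq> 0" "v \<noteq> 0" using nz uv by auto
  have "u dvd b 0" "v dvd b 2" using u v by (metis abs_dvd_iff gcd_dvd1, metis abs_dvd_iff gcd_dvd2)
  then obtain a c where a: "b 0 = u * a" and c: "b 2 = v * c" by (auto elim!: dvdE)
  have "\<beta> * (u * v) = (u * v)\<^sup>2 - (u * a) * (v * c)" using prd[of 1] by (simp add: a c uv)
  then have "(u * v) * \<beta> = (u * v) * (u * v - a * c)" by algebra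
  then have \<beta>: "\<beta> = u * v - a * c" using nz' by simp
  have "v * c = \<alpha> * (u * v) - u * a + \<beta>" using rec[of 2] by (simp add: a c uv)
  \<comment> \<open>Substituting \<beta> and adding \<open>2 * (u * v)\<close> turns the right-hand
    side into a product.\<close>
  then have \<alpha>: "(\<alpha> + 2) * (u * v) = (a + v) * (u + c)" unfolding \<beta> by algebra
  \<comment> \<open>A common divisor of either pair divides \<open>b 0 = u * a\<close>,
    \<open>b 1 = u * v\<close> and \<open>b 2 = v * c\<close>, so it is a unit.\<close>
  have cop: "coprime u c" "coprime v a"
  proof -
    have "x dvd 1" if "x dvd u" "x dvd c" for x
    proof -
      have "x dvd b 0" "x dvd b 1" "x dvd b 2" using that a c uv by (metis dvd_mult dvd_mult2)+
      then show ?thesis using g by (metis gcd_greatest)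
    qed
    then show "coprime u c" by (auto intro: coprimeI)
    have "x dvd 1" if "x dvd v" "x dvd a" for x
    proof -
      have "x dvd b 0" "x dvd b 1" "x dvd b 2" using that a c uv by (metis dvd_mult dvd_mult2)+
      then show ?thesis using g by (metis gcd_greatest)
    qed
    then show "coprime v a" by (auto intro: coprimeI)
  qed
  \<comment> \<open>Adding \<open>u\<close> or \<open>v\<close> preserves coprimality, so
    \<open>u\<close> must divide the first factor and \<open>v\<close> the second.\<close>
  have "coprime u (u + c)" "coprime v (a + v)"
    using cop by (metis coprime_iff_gcd_eq_1 gcd_add2 add.commute)+
  moreover have "u dvd (a + v) * (u + c)" "v dvd (a + v) * (u + c)"
    unfolding \<alpha>[symmetric] by simp_all
  ultimately have "u dvd a + v" "v dvd u + c"
    by (simp_all add: coprime_dvd_mult_left_iff coprime_dvd_mult_right_iff)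
  then obtain s k where s: "a + v = u * s" and k: "u + c = v * k" by (auto elim!: dvdE)
  have "(\<alpha> + 2) * (u * v) = (k * s) * (u * v)" unfolding \<alpha> s k by algebra
  then have \<alpha>': "\<alpha> = k * s - 2" using nz' by simp
  have \<beta>': "\<beta> = k * v\<^sup>2 + s * u\<^sup>2 - k * s * u * v"
    unfolding \<beta> using s k by algebra
  have b: "b 0 + b 1 = s * u\<^sup>2" "b 1 + b 2 = k * v\<^sup>2"
    unfolding a c uv[symmetric] using s k by algebra+
  have "b n = f_prod k s u v n" for n
  proof (rule affine_recurrence_unique[OF rec])
    show "f_prod k s u v n = \<alpha> * f_prod k s u v (n - 1) - f_prod k s u v (n - 2) + \<beta>" for n
      unfolding \<alpha>' \<beta>' by (rule f_prod_rec)
    \<comment> \<open>Index 1 is odd, so the backward step to -1 uses \<open>s\<close>.\<close>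
    have "f_seq k s u v (- 1) = s * u - v" using f_seq_rec[of k s u v 1] by simp
    then have "f_prod k s u v 0 = (s * u - v) * u" by (simp add: f_prod_def)
    then show "b 0 = f_prod k s u v 0" using b(1) uv by algebra
    show "b 1 = f_prod k s u v 1" using uv by (simp add: f_prod_def)
  qed
  then show ?thesis using b that by blast
qed

text \<open>The product relation at 1 gives \<open>b 1 dvd b 0 * b 2\<close>, so the gcds multiply
  to \<open>\<bar>b 1\<bar>\<close>; the first factor takes the sign of \<open>b 1\<close>.\<close>

lemma primitive_lens_sequence_factors:
  assumes prim: "primitive_lens_sequence b" and nz: "b 1 \<noteq> 0"
  obtains u v where "\<bar>u\<bar> = gcd (b 0) (b 1)" "\<bar>v\<bar> = gcd (b 1) (b 2)" "u * v = b 1"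
proof -
  have I: "integer_lens_sequence b" using prim by (simp add: primitive_lens_sequence_def)
  obtain \<alpha> \<beta> where L: "integer_lens_with \<alpha> \<beta> b"
    using integer_lens_sequence_obtains_integer_lens_with[OF I] by blast
  note rec = integer_lens_withD(1)[OF L] and prd = integer_lens_withD(2)[OF L]
  have "b 0 * b 2 = b 1 * (b 1 - \<beta>)" using prd[of 1] by (simp add: power2_eq_square algebra_simps)
  then have "\<bar>b 1\<bar> = gcd (b 0) (b 1) * gcd (b 1) (b 2)"
    by (intro abs_gcd_mult_gcd primitive_lens_sequence_gcd prim nz) simp
  then have "(sgn (b 1) * gcd (b 0) (b 1)) * gcd (b 1) (b 2) = b 1"
    by (metis mult.assoc sgn_mult_abs)
  moreover have "\<bar>sgn (b 1) * gcd (b 0) (b 1)\<bar> = gcd (b 0) (b 1)"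
    using nz by (simp add: abs_mult abs_sgn_eq)
  ultimately show ?thesis using that[of "sgn (b 1) * gcd (b 0) (b 1)" "gcd (b 1) (b 2)"] by simp
qed

lemma primitive_lens_sequence_ex_f_prod:
  assumes prim: "primitive_lens_sequence b"
  shows "\<exists>k s f0 f1. \<forall>n. b n = f_prod k s f0 f1 n"
proof (cases "b 1 = 0")
  case False
  then obtain u v where "\<bar>u\<bar> = gcd (b 0) (b 1)" "\<bar>v\<bar> = gcd (b 1) (b 2)" "u * v = b 1"
    using primitive_lens_sequence_factors[OF prim] by blast
  then show ?thesis using primitive_lens_sequence_eq_f_prod[OF prim False] by metis
next
  case True
  have I: "integer_lens_sequence b" using prim by (simp add: primitive_lens_sequence_def)
  obtain \<alpha> \<beta> where L: "integer_lens_with \<alpha> \<beta> b"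
    using integer_lens_sequence_obtains_integer_lens_with[OF I] by blast
  note rec = integer_lens_withD(1)[OF L] and prd = integer_lens_withD(2)[OF L]
  have g: "gcd (b 0) (b 2) = 1" using primitive_lens_sequence_gcd[OF prim] True by simp
  have sum: "b 0 + b 2 = \<beta>" using rec[of 2] True by simp
  have "b 0 * b 2 = 0" using prd[of 1] True by simp
  \<comment> \<open>With \<open>b 1 = 0\<close>, primitivity leaves a zero and a unit at 0 and
    2.\<close>
  then consider "b 0 = 0" "\<bar>b 2\<bar> = 1" | "b 2 = 0" "\<bar>b 0\<bar> = 1" using g by auto
  then show ?thesis
  proof cases
    case 1
    \<comment> \<open>For \<open>f0 = 0\<close>, \<open>f1 = 1\<close> the formula for \<beta>
      reduces to \<open>k\<close>, forcing \<open>k = b 2\<close>. This unit is its own inverse, so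
      \<open>k * s = \<alpha> + 2\<close> determines \<open>s\<close>.\<close>
    define k s where "k = b 2" "s = (\<alpha> + 2) * b 2"
    have sq: "b 2 * b 2 = 1" using 1 by (metis abs_mult_self_eq mult_1)
    have c: "\<alpha> = k * s - 2" "\<beta> = k * 1\<^sup>2 + s * 0\<^sup>2 - k * s * 0 * 1"
      using sq sum 1(1) by (simp_all add: k_s_def mult.left_commute[of _ "_ + _"])
    have "b n = f_prod k s 0 1 n" for n
    proof (rule affine_recurrence_unique[OF rec])
      show "f_prod k s 0 1 n = \<alpha> * f_prod k s 0 1 (n - 1) - f_prod k s 0 1 (n - 2) + \<beta>" for n
        unfolding c by (rule f_prod_rec)
    qed (use 1 True in \<open>simp_all add: f_prod_def\<close>)
    then show ?thesis by blast
  next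
    case 2
    \<comment> \<open>The mirror image: for \<open>f0 = 1\<close>, \<open>f1 = 0\<close> the formula
      for \<beta> reduces to \<open>s\<close>.\<close>
    define k s where "k = (\<alpha> + 2) * b 0" "s = b 0"
    have sq: "b 0 * b 0 = 1" using 2 by (metis abs_mult_self_eq mult_1)
    have c: "\<alpha> = k * s - 2" "\<beta> = k * 0\<^sup>2 + s * 1\<^sup>2 - k * s * 1 * 0"
      using sq sum 2(1) by (simp_all add: k_s_def mult.assoc)
    have "f_seq k s 1 0 (- 1) = s" using f_seq_rec[of k s 1 0 1] by simp
    then have i: "b 0 = f_prod k s 1 0 0" "b 1 = f_prod k s 1 0 1"
      using True by (simp_all add: f_prod_def k_s_def)
    have "b n = f_prod k s 1 0 n" for n
    proof (rule affine_recurrence_unique[OF rec])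
      show "f_prod k s 1 0 n = \<alpha> * f_prod k s 1 0 (n - 1) - f_prod k s 1 0 (n - 2) + \<beta>" for n
        unfolding c by (rule f_prod_rec)
    qed (use i in auto)
    then show ?thesis by blast
  qed
qed

section \<open>Reduction to the primitive case\<close>

text \<open>The gcd of one triple divides \<beta> and all terms. In these the recurrence is
  homogeneous of degree 1 and the product relation of degree 2, so both survive division, with
  \<alpha> unchanged.\<close>

lemma integer_lens_sequence_primitive_part:
  assumes "integer_lens_sequence b"
  obtains c where "primitive_lens_sequence c" "\<And>n. b n = gcd (b 0) (gcd (b 1) (b 2)) * c n"
proof -
  obtain \<alpha> \<beta> where L: "integer_lens_with \<alpha> \<beta> b"
    using integer_lens_sequence_obtains_integer_lens_with[OF assms] by blast
  note rec = integer_lens_withD(1)[OF L] and prd = integer_lens_withD(2)[OF L]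
  obtain m where m: "b m \<noteq> 0" using integer_lens_withD(3)[OF L] by blast
  define g where "g = gcd (b 0) (gcd (b 1) (b 2))"
  have "g dvd gcd (b (1 - 1)) (gcd (b 1) (b (1 + 1)))" by (simp add: g_def)
  then have dvd: "g dvd \<beta>" "\<And>m. g dvd b m"
    using affine_recurrence_dvd_iff[of b, OF rec] by blast+
  have g0: "g \<noteq> 0" using dvd(2)[of m] m by auto
  define c where "c n = b n div g" for n
  define \<gamma> where "\<gamma> = \<beta> div g"
  have b: "b n = g * c n" for n using dvd(2) by (simp add: c_def)
  have \<beta>: "\<beta> = g * \<gamma>" using dvd(1) by (simp add: \<gamma>_def)
  have rec_c: "c n = \<alpha> * c (n - 1) - c (n - 2) + \<gamma>" for n
  proof -
    have "g * c n = g * (\<alpha> * c (n - 1) - c (n - 2) + \<gamma>)"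
      using rec[of n] unfolding b \<beta> by algebra
    then show ?thesis using g0 by simp
  qed
  have prd_c: "\<gamma> * c n = (c n)\<^sup>2 - c (n - 1) * c (n + 1)" for n
  proof -
    have "g\<^sup>2 * (\<gamma> * c n) = g\<^sup>2 * ((c n)\<^sup>2 - c (n - 1) * c (n + 1))"
      using prd[of n] unfolding b \<beta> by algebra
    then show ?thesis using g0 by simp
  qed
  have "lens_sequence_with (real_of_int \<alpha>) (real_of_int \<gamma>) (\<lambda>n. real_of_int (c n))"
  proof (rule lens_sequence_withI[where m = m])
    show "real_of_int (c n) = real_of_int \<alpha> * real_of_int (c (n - 1)) - real_of_int (c (n - 2))
        + real_of_int \<gamma>" for n
      using arg_cong[OF rec_c[of n], of real_of_int] by simp
    show "real_of_int (c m) \<noteq> 0" using m b by simp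
    show "real_of_int \<gamma> * real_of_int (c m)
        = (real_of_int (c m))\<^sup>2 - real_of_int (c (m - 1)) * real_of_int (c (m + 1))"
      using arg_cong[OF prd_c[of m], of real_of_int] by simp
  qed
  then have "integer_lens_sequence c"
    unfolding integer_lens_sequence_def lens_sequence_def by blast
  moreover have "gcd (c (1 - 1)) (gcd (c 1) (c (1 + 1))) = 1"
  proof -
    have "g = gcd (b 0) (gcd (b 1) (b 2))" by (rule g_def)
    also have "\<dots> = gcd (g * c 0) (gcd (g * c 1) (g * c 2))" by (simp only: b)
    also have "\<dots> = \<bar>g\<bar> * gcd (c 0) (gcd (c 1) (c 2))"
      by (simp add: gcd_mult_left[of g "c 1" "c 2"] gcd_mult_distrib_int)
    also have "\<bar>g\<bar> = g" by (simp add: g_def)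
    finally show ?thesis using g0 by simp
  qed
  ultimately have "primitive_lens_sequence c"
    unfolding primitive_lens_sequence_def by (intro conjI exI[of _ 1])
  moreover have "b n = gcd (b 0) (gcd (b 1) (b 2)) * c n" for n
    using b[of n] by (simp only: g_def[symmetric])
  ultimately show ?thesis by (rule that)
qed

text \<open>The second conjunct carries a gcd factor because \<open>const_3_not_f_prod\<close>
  refutes the plain form for arbitrary integer lens sequences. The real quotients for
  \<open>s\<close> and \<open>k\<close> assert exact divisibility, which \<open>div\<close> would
  not.\<close>

theorem theorem5p4:
  shows
    "(\<forall>(k::int) (s::int) (f0::int) (f1::int).
        let b = f_prod k s f0 f1;
            \<alpha> = k * s - 2;
            \<beta> = k * f1\<^sup>2 + s * f0\<^sup>2 - k * s * f0 * f1
        in (\<forall>n. b n = \<alpha> * b (n - 1) - b (n - 2) + \<beta>) \<and>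
           ((\<exists>n. b n \<noteq> 0) \<longrightarrow>
              lens_sequence_with (real_of_int \<alpha>) (real_of_int \<beta>) (\<lambda>n. real_of_int (b n))))
   \<and> (\<forall>b. integer_lens_sequence b \<longrightarrow>
        (\<exists>k s f0 f1. \<forall>n. b n = gcd (b 0) (gcd (b 1) (b 2)) * f_prod k s f0 f1 n))
   \<and> (\<forall>b. primitive_lens_sequence b \<longrightarrow>
        (\<exists>k s f0 f1. \<forall>n. b n = f_prod k s f0 f1 n))
   \<and> (\<forall>b. primitive_lens_sequence b \<and> b 1 \<noteq> 0 \<longrightarrow>
        (\<exists>f0 f1. \<bar>f0\<bar> = gcd (b 0) (b 1) \<and> \<bar>f1\<bar> = gcd (b 1) (b 2) \<and> f0 * f1 = b 1) \<and>
        (\<forall>f0 f1. \<bar>f0\<bar> = gcd (b 0) (b 1) \<and> \<bar>f1\<bar> = gcd (b 1) (b 2) \<and> f0 * f1 = b 1 \<longrightarrow>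
           (\<exists>k s. real_of_int s = real_of_int (b 0 + b 1) / (real_of_int f0)\<^sup>2 \<and>
                  real_of_int k = real_of_int (b 1 + b 2) / (real_of_int f1)\<^sup>2 \<and>
                  (\<forall>n. b n = f_prod k s f0 f1 n))))"
proof (intro conjI allI impI)
  fix k s f0 f1 :: int
  show "let b = f_prod k s f0 f1; \<alpha> = k * s - 2; \<beta> = k * f1\<^sup>2 + s * f0\<^sup>2 - k * s * f0 * f1
    in (\<forall>n. b n = \<alpha> * b (n - 1) - b (n - 2) + \<beta>) \<and>
       ((\<exists>n. b n \<noteq> 0) \<longrightarrow>
          lens_sequence_with (real_of_int \<alpha>) (real_of_int \<beta>) (\<lambda>n. real_of_int (b n)))"
    unfolding Let_def using f_prod_rec f_prod_lens_sequence_with by blast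
next
  fix b assume "integer_lens_sequence b"
  then obtain c where "primitive_lens_sequence c" "\<And>n. b n = gcd (b 0) (gcd (b 1) (b 2)) * c n"
    using integer_lens_sequence_primitive_part by blast
  then show "\<exists>k s f0 f1. \<forall>n. b n = gcd (b 0) (gcd (b 1) (b 2)) * f_prod k s f0 f1 n"
    using primitive_lens_sequence_ex_f_prod by metis
next
  fix b assume "primitive_lens_sequence b"
  then show "\<exists>k s f0 f1. \<forall>n. b n = f_prod k s f0 f1 n"
    by (rule primitive_lens_sequence_ex_f_prod)
next
  fix b assume "primitive_lens_sequence b \<and> b 1 \<noteq> 0"
  then show "\<exists>f0 f1. \<bar>f0\<bar> = gcd (b 0) (b 1) \<and> \<bar>f1\<bar> = gcd (b 1) (b 2) \<and> f0 * f1 = b 1"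
    using primitive_lens_sequence_factors by blast
next
  fix b f0 f1
  assume b: "primitive_lens_sequence b \<and> b 1 \<noteq> 0"
    and f: "\<bar>f0\<bar> = gcd (b 0) (b 1) \<and> \<bar>f1\<bar> = gcd (b 1) (b 2) \<and> f0 * f1 = b 1"
  then obtain k s where ks: "b 0 + b 1 = s * f0\<^sup>2" "b 1 + b 2 = k * f1\<^sup>2"
    and eq: "\<forall>n. b n = f_prod k s f0 f1 n"
    using primitive_lens_sequence_eq_f_prod by metis
  have "f0 \<noteq> 0" "f1 \<noteq> 0" using b f by auto
  then have "real_of_int s = real_of_int (b 0 + b 1) / (real_of_int f0)\<^sup>2"
    "real_of_int k = real_of_int (b 1 + b 2) / (real_of_int f1)\<^sup>2"
    unfolding ks by simp_all
  then show "\<exists>k s. real_of_int s = real_of_int (b 0 + b 1) / (real_of_int f0)\<^sup>2 \<and>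
      real_of_int k = real_of_int (b 1 + b 2) / (real_of_int f1)\<^sup>2 \<and> (\<forall>n. b n = f_prod k s f0 f1 n)"
    using eq by blast
qed

end
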